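(* Let $\theta_i>0$ and let $\psi_i:\mathcal X\times\mathcal Y\to\mathbb R$, $i\leq I$, be given by $\mathcal K$-representations $$\psi_i(x,y)=\inf_{f_i,t_i,u_i}\{f_i^Ty+t_i: P_if_i+t_ip_i+Q_iu_i+R_ix\leq_{\mathbf K_i}s_i\}\quad\forall x\in\mathcal X,\ y\in\mathcal Y\qquad[\mathbf K_i\in\mathcal K].$$ Then for all $x\in\mathcal X$, $y\in\mathcal Y$ the function $\psi(x,y):=\sum_i\theta_i\psi_i(x,y)$ satisfies $$\psi(x,y)=\inf_{f,t,\{f_i,t_i,u_i,\,i\leq I\}}\left\{f^Ty+t:\ \begin{array}{l} f=\sum_i\theta_if_i,\ t=\sum_i\theta_it_i,\\ P_if_i+t_ip_i+Q_iu_i+R_ix\leq_{\mathbf K_i}s_i,\ 1\leq i\leq I\end{array}\right\},$$ which is a $\mathcal K$-representation of $\psi$ on $\mathcal X\times\mathcal Y$.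
   Context: $\mathcal K$ is a fixed family of regular cones (closed, convex, pointed, with nonempty interior) in Euclidean spaces which contains $\mathbb R_+$, is closed under finite direct products, and is closed under passing to dual cones. $a\leq_{\mathbf K}b$ means $b-a\in\mathbf K$. Finite systems of $\mathcal K$-conic constraints, linear equalities and nonstrict linear inequalities are (equivalent to) a single $\mathcal K$-conic constraint. $\mathcal X,\mathcal Y$ are nonempty, convex and $\mathcal K$-representable, i.e. of the form $\{x:\exists u:Ax+Bu\leq_{\mathbf K}c\}$ with $\mathbf K\in\mathcal K$. A $\mathcal K$-representation of a real-valued function $\psi$ on $\mathcal X\times\mathcal Y$ (convex in $x\in\mathcal X$, concave in $y\in\mathcal Y$, continuous) is an identity $\psi(x,y)=\inf_{f,t,u}\{f^Ty+t:Pf+tp+Qu+Rx\leq_{\mathbf K}s\}$ valid for all $x\in\mathcal X,y\in\mathcal Y$, with $\mathbf K\in\mathcal K$ (the constraint may be given as an equivalent finite system). *)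

theory Defs
  imports
    "HOL-Analysis.Abstract_Metric_Spaces"
    "HOL-Analysis.L2_Norm"
    "HOL-Library.Extended_Real"
    "Jordan_Normal_Form.Matrix"
begin

text \<open>
  The dimensions of the Euclidean spaces vary inside one family of cones, so Euclidean
  n-space is \<^term>\<open>carrier_vec n :: real vec set\<close> with its Euclidean metric.
\<close>

definition vec_dist :: "nat \<Rightarrow> real vec \<Rightarrow> real vec \<Rightarrow> real" where
  "vec_dist n v w = L2_set (\<lambda>i. v $ i - w $ i) {..<n}"

lemma Metric_space_vec: "Metric_space (carrier_vec n) (vec_dist n)"
proof
  fix x y z :: "real vec"
  show "0 \<le> vec_dist n x y"
    by (simp add: vec_dist_def L2_set_nonneg)
  show "vec_dist n x y = vec_dist n y x"
    by (simp add: vec_dist_def L2_set_def power2_commute)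
  assume x: "x \<in> carrier_vec n" and y: "y \<in> carrier_vec n"
  then show "vec_dist n x y = 0 \<longleftrightarrow> x = y"
    by (auto simp: vec_dist_def L2_set_eq_0_iff)
  have "vec_dist n x z = L2_set (\<lambda>i. (x $ i - y $ i) + (y $ i - z $ i)) {..<n}"
    by (simp add: vec_dist_def)
  also have "\<dots> \<le> vec_dist n x y + vec_dist n y z"
    unfolding vec_dist_def by (rule L2_set_triangle_ineq)
  finally show "vec_dist n x z \<le> vec_dist n x y + vec_dist n y z" .
qed

definition vec_topology :: "nat \<Rightarrow> real vec topology" where
  "vec_topology n = Metric_space.mtopology (carrier_vec n) (vec_dist n)"

definition vec_convex :: "real vec set \<Rightarrow> bool" where
  "vec_convex C \<longleftrightarrow>
     (\<forall>v\<in>C. \<forall>w\<in>C. \<forall>a\<in>{0..1}. a \<cdot>\<^sub>v v + (1 - a) \<cdot>\<^sub>v w \<in> C)"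

definition regular_cone :: "nat \<Rightarrow> real vec set \<Rightarrow> bool" where
  "regular_cone n K \<longleftrightarrow>
     K \<subseteq> carrier_vec n \<and>
     (\<forall>v\<in>K. \<forall>a\<ge>0. a \<cdot>\<^sub>v v \<in> K) \<and>
     vec_convex K \<and>
     closedin (vec_topology n) K \<and>
     (\<forall>v. v \<in> K \<and> - v \<in> K \<longrightarrow> v = 0\<^sub>v n) \<and>
     vec_topology n interior_of K \<noteq> {}"

definition nonneg_ray :: "real vec set" where
  "nonneg_ray = {v \<in> carrier_vec 1. 0 \<le> v $ 0}"

definition dual_cone :: "nat \<Rightarrow> real vec set \<Rightarrow> real vec set" where
  "dual_cone n K = {w \<in> carrier_vec n. \<forall>v\<in>K. 0 \<le> w \<bullet> v}"

definition append_vecs :: "real vec list \<Rightarrow> real vec" where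
  "append_vecs vs = foldr (@\<^sub>v) vs (0\<^sub>v 0)"

definition direct_product :: "real vec set list \<Rightarrow> real vec set" where
  "direct_product Ks = {append_vecs vs | vs. list_all2 (\<in>) vs Ks}"

definition cone_family :: "real vec set set \<Rightarrow> bool" where
  "cone_family \<K> \<longleftrightarrow>
     (\<forall>K\<in>\<K>. \<exists>n. regular_cone n K) \<and>
     nonneg_ray \<in> \<K> \<and>
     (\<forall>Ks. Ks \<noteq> [] \<and> set Ks \<subseteq> \<K> \<longrightarrow> direct_product Ks \<in> \<K>) \<and>
     (\<forall>n. \<forall>K\<in>\<K>. K \<subseteq> carrier_vec n \<longrightarrow> dual_cone n K \<in> \<K>)"

definition cone_le :: "real vec set \<Rightarrow> real vec \<Rightarrow> real vec \<Rightarrow> bool" where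
  "cone_le K a b \<longleftrightarrow> b - a \<in> K"

definition representable_set :: "real vec set set \<Rightarrow> nat \<Rightarrow> real vec set \<Rightarrow> bool" where
  "representable_set \<K> n X \<longleftrightarrow>
     (\<exists>K\<in>\<K>. \<exists>m k A B c.
        K \<subseteq> carrier_vec m \<and> A \<in> carrier_mat m n \<and> B \<in> carrier_mat m k \<and> c \<in> carrier_vec m \<and>
        X = {x \<in> carrier_vec n. \<exists>u\<in>carrier_vec k. cone_le K (A *\<^sub>v x + B *\<^sub>v u) c})"

definition convex_concave_on ::
    "real vec set \<Rightarrow> real vec set \<Rightarrow> (real vec \<Rightarrow> real vec \<Rightarrow> real) \<Rightarrow> bool" where
  "convex_concave_on X Y \<psi> \<longleftrightarrow>
     (\<forall>y\<in>Y. \<forall>x\<in>X. \<forall>x'\<in>X. \<forall>a\<in>{0..1}.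
        \<psi> (a \<cdot>\<^sub>v x + (1 - a) \<cdot>\<^sub>v x') y \<le> a * \<psi> x y + (1 - a) * \<psi> x' y) \<and>
     (\<forall>x\<in>X. \<forall>y\<in>Y. \<forall>y'\<in>Y. \<forall>a\<in>{0..1}.
        a * \<psi> x y + (1 - a) * \<psi> x y' \<le> \<psi> x (a \<cdot>\<^sub>v y + (1 - a) \<cdot>\<^sub>v y'))"

definition jointly_continuous_on ::
    "nat \<Rightarrow> nat \<Rightarrow> real vec set \<Rightarrow> real vec set \<Rightarrow> (real vec \<Rightarrow> real vec \<Rightarrow> real) \<Rightarrow> bool" where
  "jointly_continuous_on nx ny X Y \<psi> \<longleftrightarrow>
     continuous_map (subtopology (prod_topology (vec_topology nx) (vec_topology ny)) (X \<times> Y))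
       euclideanreal (\<lambda>(x, y). \<psi> x y)"

definition rep_constraint ::
    "real vec set \<Rightarrow> real mat \<Rightarrow> real vec \<Rightarrow> real mat \<Rightarrow> real mat \<Rightarrow> real vec \<Rightarrow>
     real vec \<Rightarrow> real vec \<Rightarrow> real \<Rightarrow> real vec \<Rightarrow> bool" where
  "rep_constraint K P p Q R s x f t u \<longleftrightarrow>
     cone_le K (P *\<^sub>v f + t \<cdot>\<^sub>v p + Q *\<^sub>v u + R *\<^sub>v x) s"

text \<open>
  The dimension of the cone is \<^term>\<open>dim_vec s\<close> and the dimension of the additional
  variable u is \<^term>\<open>dim_col Q\<close>. The infimum is taken in the extended reals, so the
  identity entails that the constraint is feasible and the objective bounded below on it.
\<close>

definition K_representation ::
    "real vec set set \<Rightarrow> nat \<Rightarrow> nat \<Rightarrow> real vec set \<Rightarrow> real vec set \<Rightarrow>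
     (real vec \<Rightarrow> real vec \<Rightarrow> real) \<Rightarrow>
     real vec set \<Rightarrow> real mat \<Rightarrow> real vec \<Rightarrow> real mat \<Rightarrow> real mat \<Rightarrow> real vec \<Rightarrow> bool" where
  "K_representation \<K> nx ny X Y \<psi> K P p Q R s \<longleftrightarrow>
     convex_concave_on X Y \<psi> \<and> jointly_continuous_on nx ny X Y \<psi> \<and>
     K \<in> \<K> \<and> K \<subseteq> carrier_vec (dim_vec s) \<and>
     P \<in> carrier_mat (dim_vec s) ny \<and> p \<in> carrier_vec (dim_vec s) \<and>
     Q \<in> carrier_mat (dim_vec s) (dim_col Q) \<and> R \<in> carrier_mat (dim_vec s) nx \<and>
     (\<forall>x\<in>X. \<forall>y\<in>Y.
        ereal (\<psi> x y) =
        Inf {ereal (f \<bullet> y + t) | f t u.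
               f \<in> carrier_vec ny \<and> u \<in> carrier_vec (dim_col Q) \<and>
               rep_constraint K P p Q R s x f t u})"

text \<open>
  The constraint system of the weighted sum, in the variables f, t and
  \<open>F i\<close>, \<open>T i\<close>, \<open>U i\<close> for i from 1 to I.
\<close>

definition sum_system ::
    "nat \<Rightarrow> nat \<Rightarrow> (nat \<Rightarrow> real) \<Rightarrow>
     (nat \<Rightarrow> real vec set) \<Rightarrow> (nat \<Rightarrow> real mat) \<Rightarrow> (nat \<Rightarrow> real vec) \<Rightarrow>
     (nat \<Rightarrow> real mat) \<Rightarrow> (nat \<Rightarrow> real mat) \<Rightarrow> (nat \<Rightarrow> real vec) \<Rightarrow>
     real vec \<Rightarrow> real vec \<Rightarrow> real \<Rightarrow>
     (nat \<Rightarrow> real vec) \<Rightarrow> (nat \<Rightarrow> real) \<Rightarrow> (nat \<Rightarrow> real vec) \<Rightarrow> bool" where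
  "sum_system ny I \<theta> K P p Q R s x f t F T U \<longleftrightarrow>
     f = finsum_vec TYPE(real) ny (\<lambda>i. \<theta> i \<cdot>\<^sub>v F i) {1..I} \<and>
     t = (\<Sum>i=1..I. \<theta> i * T i) \<and>
     (\<forall>i\<in>{1..I}. rep_constraint (K i) (P i) (p i) (Q i) (R i) (s i) x (F i) (T i) (U i))"

definition system_vars ::
    "nat \<Rightarrow> nat \<Rightarrow> (nat \<Rightarrow> real mat) \<Rightarrow> (nat \<Rightarrow> real vec) \<Rightarrow> (nat \<Rightarrow> real vec) \<Rightarrow> bool" where
  "system_vars ny I Q F U \<longleftrightarrow>
     (\<forall>i\<in>{1..I}. F i \<in> carrier_vec ny \<and> U i \<in> carrier_vec (dim_col (Q i)))"

text \<open>
  The variables \<open>F i\<close>, \<open>T i\<close>, \<open>U i\<close>, i from 1 to I, stacked into one vector.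
\<close>

definition stack_vars ::
    "nat \<Rightarrow> (nat \<Rightarrow> real vec) \<Rightarrow> (nat \<Rightarrow> real) \<Rightarrow> (nat \<Rightarrow> real vec) \<Rightarrow> real vec" where
  "stack_vars I F T U = append_vecs (map (\<lambda>i. F i @\<^sub>v vCons (T i) (U i)) [1..<Suc I])"

end

theory Submission
  imports Defs
begin

text \<open>
  The value identity holds because the summands have independent variables, so the infimum of
  the nonnegatively weighted sum of the objectives is the weighted sum of the finite infima.
  The system is one conic constraint because constraints over the same variables combine under
  direct products of cones: each linear equation is a pair of half-spaces, that is, constraints
  over the nonnegative ray, and each summand's constraint is pulled back along the coordinate
  projections of the stacked vector.
\<close>

section \<open>Closure properties of conic constraints in the variables x, f, t, u\<close>

text \<open>The cone and the matrices are hidden behind existential quantifiers so that constraints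
  can be combined without tracking their data. The fixed dimension \<open>N\<close> makes all
  combined constraints share one variable \<open>u\<close>. The equivalence ranges over the whole
  space of \<open>x\<close> because the final correspondence with \<open>sum_system\<close> is not
  restricted to \<open>X\<close>.\<close>

definition conic_expressible ::
    "real vec set set \<Rightarrow> nat \<Rightarrow> nat \<Rightarrow> nat \<Rightarrow>
     (real vec \<Rightarrow> real vec \<Rightarrow> real \<Rightarrow> real vec \<Rightarrow> bool) \<Rightarrow> bool" where
  "conic_expressible \<K> nx ny N C \<longleftrightarrow>
     (\<exists>K\<in>\<K>. \<exists>P p Q R s.
        K \<subseteq> carrier_vec (dim_vec s) \<and>
        P \<in> carrier_mat (dim_vec s) ny \<and> p \<in> carrier_vec (dim_vec s) \<and>
        Q \<in> carrier_mat (dim_vec s) N \<and> R \<in> carrier_mat (dim_vec s) nx \<and>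
        (\<forall>x\<in>carrier_vec nx. \<forall>f\<in>carrier_vec ny. \<forall>t. \<forall>u\<in>carrier_vec N.
           rep_constraint K P p Q R s x f t u \<longleftrightarrow> C x f t u))"

lemma conic_expressibleI:
  assumes "K \<in> \<K>" "K \<subseteq> carrier_vec (dim_vec s)"
    "P \<in> carrier_mat (dim_vec s) ny" "p \<in> carrier_vec (dim_vec s)"
    "Q \<in> carrier_mat (dim_vec s) N" "R \<in> carrier_mat (dim_vec s) nx"
    "\<And>x f t u. x \<in> carrier_vec nx \<Longrightarrow> f \<in> carrier_vec ny \<Longrightarrow> u \<in> carrier_vec N \<Longrightarrow>
       rep_constraint K P p Q R s x f t u \<longleftrightarrow> C x f t u"
  shows "conic_expressible \<K> nx ny N C"
  unfolding conic_expressible_def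
  by (intro bexI[of _ K] exI[of _ P] exI[of _ p] exI[of _ Q] exI[of _ R] exI[of _ s] conjI ballI allI assms)

lemma conic_expressibleE:
  assumes "conic_expressible \<K> nx ny N C"
  obtains K P p Q R s where "K \<in> \<K>" "K \<subseteq> carrier_vec (dim_vec s)"
    "P \<in> carrier_mat (dim_vec s) ny" "p \<in> carrier_vec (dim_vec s)"
    "Q \<in> carrier_mat (dim_vec s) N" "R \<in> carrier_mat (dim_vec s) nx"
    "\<And>x f t u. x \<in> carrier_vec nx \<Longrightarrow> f \<in> carrier_vec ny \<Longrightarrow> u \<in> carrier_vec N \<Longrightarrow>
       rep_constraint K P p Q R s x f t u \<longleftrightarrow> C x f t u"
  using assms unfolding conic_expressible_def
  by (elim bexE exE conjE) (rule that, assumption+, simp)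

lemma conic_expressible_cong:
  assumes "conic_expressible \<K> nx ny N C"
    and "\<And>x f t u. x \<in> carrier_vec nx \<Longrightarrow> f \<in> carrier_vec ny \<Longrightarrow> u \<in> carrier_vec N \<Longrightarrow>
           C x f t u \<longleftrightarrow> C' x f t u"
  shows "conic_expressible \<K> nx ny N C'"
  using assms(1)
proof (rule conic_expressibleE)
  fix K P p Q R s
  assume "K \<in> \<K>" "K \<subseteq> carrier_vec (dim_vec s)"
    "P \<in> carrier_mat (dim_vec s) ny" "p \<in> carrier_vec (dim_vec s)"
    "Q \<in> carrier_mat (dim_vec s) N" "R \<in> carrier_mat (dim_vec s) nx"
    "\<And>x f t u. x \<in> carrier_vec nx \<Longrightarrow> f \<in> carrier_vec ny \<Longrightarrow> u \<in> carrier_vec N \<Longrightarrow>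
       rep_constraint K P p Q R s x f t u \<longleftrightarrow> C x f t u"
  then show ?thesis
    using assms(2) by (intro conic_expressibleI[of K \<K> s P ny p Q N R]) simp_all
qed

text \<open>All coefficients enter negated: with right-hand side zero, the cone order asks that zero
  minus the left-hand side lie in \<open>nonneg_ray\<close>, which restores the signs.\<close>

lemma conic_expressible_halfspace:
  assumes "cone_family \<K>" and a: "a \<in> carrier_vec ny" and c: "c \<in> carrier_vec N"
  shows "conic_expressible \<K> nx ny N (\<lambda>x f t u. 0 \<le> a \<bullet> f + t * b + c \<bullet> u)"
proof -
  let ?P = "mat_of_row (- a)" and ?p = "vec 1 (\<lambda>_. - b)" and ?Q = "mat_of_row (- c)"
  have "rep_constraint nonneg_ray ?P ?p ?Q (0\<^sub>m 1 nx) (0\<^sub>v 1) x f t u \<longleftrightarrow>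
        0 \<le> a \<bullet> f + t * b + c \<bullet> u"
    if "x \<in> carrier_vec nx" "f \<in> carrier_vec ny" "u \<in> carrier_vec N" for x f t u
  proof -
    have "- a \<bullet> f = - (a \<bullet> f)" "- c \<bullet> u = - (c \<bullet> u)" "0\<^sub>v nx \<bullet> x = 0"
      using that a c by (simp_all add: scalar_prod_def sum_negf)
    moreover have "?P *\<^sub>v f + t \<cdot>\<^sub>v ?p + ?Q *\<^sub>v u + 0\<^sub>m 1 nx *\<^sub>v x \<in> carrier_vec 1"
      using that a c by (auto intro!: carrier_vecI)
    ultimately show ?thesis
      by (auto simp: rep_constraint_def cone_le_def nonneg_ray_def)
  qed
  then show ?thesis
    using assms by (intro conic_expressibleI[of nonneg_ray \<K> "0\<^sub>v 1" ?P ny ?p ?Q N "0\<^sub>m 1 nx"])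
      (auto simp: nonneg_ray_def cone_family_def)
qed

text \<open>The half-space with zero coefficients is everything. This starts the induction over
  finite conjunctions and covers an empty index set.\<close>

lemma conic_expressible_True:
  assumes "cone_family \<K>"
  shows "conic_expressible \<K> nx ny N (\<lambda>x f t u. True)"
  by (rule conic_expressible_cong[OF conic_expressible_halfspace[OF assms, of "0\<^sub>v ny" ny "0\<^sub>v N" N nx 0]])
     auto

lemma direct_product_pair: "direct_product [K, L] = {a @\<^sub>v b | a b. a \<in> K \<and> b \<in> L}"
proof -
  have "list_all2 (\<in>) vs [K, L] \<longleftrightarrow> (\<exists>a\<in>K. \<exists>b\<in>L. vs = [a, b])" for vs
    by (auto simp: list_all2_Cons2)
  moreover have "append_vecs [a, b] = a @\<^sub>v b" for a b
    by (auto simp: append_vecs_def intro!: eq_vecI)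
  ultimately have "z \<in> direct_product [K, L] \<longleftrightarrow> (\<exists>a\<in>K. \<exists>b\<in>L. z = a @\<^sub>v b)" for z
    unfolding direct_product_def mem_Collect_eq by metis
  then show ?thesis
    by blast
qed

text \<open>All elements of \<open>K\<close> have the same dimension \<open>m\<close> as
  \<open>v\<close>, so the place where a member of the product splits into its two factors is
  forced.\<close>

lemma append_vec_mem_direct_product:
  assumes "K \<subseteq> carrier_vec m" and "v \<in> carrier_vec m"
  shows "v @\<^sub>v w \<in> direct_product [K, L] \<longleftrightarrow> v \<in> K \<and> w \<in> L"
proof -
  have "v @\<^sub>v w \<in> direct_product [K, L] \<longleftrightarrow> (\<exists>a\<in>K. \<exists>b\<in>L. v @\<^sub>v w = a @\<^sub>v b)"
    by (auto simp: direct_product_pair)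
  also have "\<dots> \<longleftrightarrow> (\<exists>a\<in>K. \<exists>b\<in>L. v = a \<and> w = b)"
    using append_vec_eq[of v m] assms by (intro bex_cong refl) auto
  finally show ?thesis
    by simp
qed

text \<open>Stacking the two sets of data row by row makes the slack vector the concatenation of the
  two slacks, and this lies in the product cone exactly when each slack lies in its own
  cone.\<close>

lemma conic_expressible_conj:
  assumes fam: "cone_family \<K>"
    and C: "conic_expressible \<K> nx ny N C" and D: "conic_expressible \<K> nx ny N D"
  shows "conic_expressible \<K> nx ny N (\<lambda>x f t u. C x f t u \<and> D x f t u)"
proof -
  obtain K P p Q R s where K: "K \<in> \<K>" "K \<subseteq> carrier_vec (dim_vec s)"
    "P \<in> carrier_mat (dim_vec s) ny" "p \<in> carrier_vec (dim_vec s)"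
    "Q \<in> carrier_mat (dim_vec s) N" "R \<in> carrier_mat (dim_vec s) nx"
    and C': "\<And>x f t u. x \<in> carrier_vec nx \<Longrightarrow> f \<in> carrier_vec ny \<Longrightarrow> u \<in> carrier_vec N \<Longrightarrow>
      rep_constraint K P p Q R s x f t u \<longleftrightarrow> C x f t u"
    using C by (rule conic_expressibleE) (rule that, assumption+)
  obtain L P' p' Q' R' s' where L: "L \<in> \<K>" "L \<subseteq> carrier_vec (dim_vec s')"
    "P' \<in> carrier_mat (dim_vec s') ny" "p' \<in> carrier_vec (dim_vec s')"
    "Q' \<in> carrier_mat (dim_vec s') N" "R' \<in> carrier_mat (dim_vec s') nx"
    and D': "\<And>x f t u. x \<in> carrier_vec nx \<Longrightarrow> f \<in> carrier_vec ny \<Longrightarrow> u \<in> carrier_vec N \<Longrightarrow>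
      rep_constraint L P' p' Q' R' s' x f t u \<longleftrightarrow> D x f t u"
    using D by (rule conic_expressibleE) (rule that, assumption+)
  have "rep_constraint (direct_product [K, L]) (P @\<^sub>r P') (p @\<^sub>v p') (Q @\<^sub>r Q') (R @\<^sub>r R')
          (s @\<^sub>v s') x f t u \<longleftrightarrow> C x f t u \<and> D x f t u"
    if x: "x \<in> carrier_vec nx" and f: "f \<in> carrier_vec ny" and u: "u \<in> carrier_vec N" for x f t u
  proof -
    have "(s @\<^sub>v s') - ((P @\<^sub>r P') *\<^sub>v f + t \<cdot>\<^sub>v (p @\<^sub>v p') + (Q @\<^sub>r Q') *\<^sub>v u + (R @\<^sub>r R') *\<^sub>v x) =
      (s - (P *\<^sub>v f + t \<cdot>\<^sub>v p + Q *\<^sub>v u + R *\<^sub>v x)) @\<^sub>v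
      (s' - (P' *\<^sub>v f + t \<cdot>\<^sub>v p' + Q' *\<^sub>v u + R' *\<^sub>v x))"
      unfolding mat_mult_append[OF K(3) L(3) f] mat_mult_append[OF K(5) L(5) u]
        mat_mult_append[OF K(6) L(6) x]
      by (rule eq_vecI) (use K L in auto)
    moreover have "s - (P *\<^sub>v f + t \<cdot>\<^sub>v p + Q *\<^sub>v u + R *\<^sub>v x) \<in> carrier_vec (dim_vec s)"
      using K by (auto intro!: carrier_vecI)
    ultimately show ?thesis
      unfolding C'[OF x f u, of t, symmetric] D'[OF x f u, of t, symmetric]
      by (simp add: rep_constraint_def cone_le_def append_vec_mem_direct_product[OF K(2)])
  qed
  moreover have "direct_product [K, L] \<in> \<K>"
    using fam K(1) L(1) unfolding cone_family_def by simp
  moreover have "direct_product [K, L] \<subseteq> carrier_vec (dim_vec (s @\<^sub>v s'))"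
  proof
    fix z assume "z \<in> direct_product [K, L]"
    then obtain a b where "z = a @\<^sub>v b" "a \<in> carrier_vec (dim_vec s)" "b \<in> carrier_vec (dim_vec s')"
      using K(2) L(2) by (auto simp: direct_product_pair)
    then show "z \<in> carrier_vec (dim_vec (s @\<^sub>v s'))"
      by (intro carrier_vecI) simp
  qed
  ultimately show ?thesis
    using K L by (intro conic_expressibleI[of "direct_product [K, L]" \<K> "s @\<^sub>v s'" "P @\<^sub>r P'" ny
          "p @\<^sub>v p'" "Q @\<^sub>r Q'" N "R @\<^sub>r R'"]) auto
qed

lemma conic_expressible_Ball:
  assumes fam: "cone_family \<K>" and "finite A"
    and "\<And>i. i \<in> A \<Longrightarrow> conic_expressible \<K> nx ny N (C i)"
  shows "conic_expressible \<K> nx ny N (\<lambda>x f t u. \<forall>i\<in>A. C i x f t u)"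
  using assms(2,3)
proof (induction A rule: finite_induct)
  case empty
  then show ?case
    using conic_expressible_True[OF fam] by simp
next
  case (insert i A)
  then have "conic_expressible \<K> nx ny N (\<lambda>x f t u. C i x f t u \<and> (\<forall>j\<in>A. C j x f t u))"
    by (intro conic_expressible_conj[OF fam]) auto
  then show ?case
    by simp
qed

text \<open>The two half-spaces have coefficients \<open>(a, b, -c)\<close> and
  \<open>(-a, -b, c)\<close>. Keeping \<open>u\<close> on the right fits the defining equations of
  \<open>f\<close> and \<open>t\<close> in \<open>sum_system\<close>.\<close>

lemma conic_expressible_equation:
  assumes fam: "cone_family \<K>" and a: "a \<in> carrier_vec ny" and c: "c \<in> carrier_vec N"
  shows "conic_expressible \<K> nx ny N (\<lambda>x f t u. a \<bullet> f + t * b = c \<bullet> u)"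
  by (rule conic_expressible_cong[OF conic_expressible_conj[OF fam
        conic_expressible_halfspace[OF fam a uminus_carrier_vec[THEN iffD2, OF c], of nx b]
        conic_expressible_halfspace[OF fam uminus_carrier_vec[THEN iffD2, OF a] c, of nx "- b"]]])
     (use a c in auto)

text \<open>Once the original variables are replaced by linear functions of the new
  \<open>u\<close>, every term except the one in \<open>x\<close> is linear in \<open>u\<close>. All
  of these merge into one coefficient matrix for \<open>u\<close>, and the coefficients of the outer
  \<open>f\<close> and \<open>t\<close> become zero.\<close>

lemma conic_expressible_pullback:
  assumes "K \<in> \<K>" "K \<subseteq> carrier_vec (dim_vec s)"
    and P: "P \<in> carrier_mat (dim_vec s) ny" and p: "p \<in> carrier_vec (dim_vec s)"
    and Q: "Q \<in> carrier_mat (dim_vec s) k" and R: "R \<in> carrier_mat (dim_vec s) nx"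
    and A: "A \<in> carrier_mat ny N" and b: "b \<in> carrier_vec N" and B: "B \<in> carrier_mat k N"
  shows "conic_expressible \<K> nx ny N
           (\<lambda>x f t u. rep_constraint K P p Q R s x (A *\<^sub>v u) (b \<bullet> u) (B *\<^sub>v u))"
proof -
  define m where "m = dim_vec s"
  \<comment> \<open>The outer product of \<open>p\<close> and \<open>b\<close>: applied to
    \<open>u\<close> it gives \<open>p\<close> scaled by \<open>b \<bullet> u\<close>, so it
    accounts for the term that carried \<open>t\<close>.\<close>
  let ?b = "mat m N (\<lambda>(i, j). p $ i * b $ j)"
  let ?Q = "P * A + ?b + Q * B"
  have c: "P * A \<in> carrier_mat m N" "?b \<in> carrier_mat m N" "Q * B \<in> carrier_mat m N"
    using P Q A B by (auto simp: m_def)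
  have eq: "0\<^sub>m m ny *\<^sub>v f + t \<cdot>\<^sub>v 0\<^sub>v m + ?Q *\<^sub>v u + R *\<^sub>v x =
        P *\<^sub>v (A *\<^sub>v u) + (b \<bullet> u) \<cdot>\<^sub>v p + Q *\<^sub>v (B *\<^sub>v u) + R *\<^sub>v x"
    if "x \<in> carrier_vec nx" "f \<in> carrier_vec ny" and u: "u \<in> carrier_vec N" for x f t u
  proof -
    have "?b *\<^sub>v u = (b \<bullet> u) \<cdot>\<^sub>v p"
      by (rule eq_vecI) (use u b p in \<open>auto simp: m_def scalar_prod_def sum_distrib_left mult_ac\<close>)
    then have "?Q *\<^sub>v u = P *\<^sub>v (A *\<^sub>v u) + (b \<bullet> u) \<cdot>\<^sub>v p + Q *\<^sub>v (B *\<^sub>v u)"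
      using u c P Q A B by (simp add: add_mult_distrib_mat_vec[where nr = m and nc = N] m_def)
    moreover have "0\<^sub>m m ny *\<^sub>v f + t \<cdot>\<^sub>v 0\<^sub>v m + w = w" if "w \<in> carrier_vec m" for w
      using that \<open>f \<in> _\<close> by (intro eq_vecI) auto
    moreover have "?Q *\<^sub>v u \<in> carrier_vec m"
      by (rule mult_mat_vec_carrier[OF add_carrier_mat[OF c(3)] u])
    ultimately show ?thesis
      by simp
  qed
  show ?thesis
  proof (rule conic_expressibleI[OF assms(1,2)])
    show "?Q \<in> carrier_mat (dim_vec s) N"
      using add_carrier_mat[OF c(3)] by (simp add: m_def)
    show "rep_constraint K (0\<^sub>m m ny) (0\<^sub>v m) ?Q R s x f t u \<longleftrightarrow>
          rep_constraint K P p Q R s x (A *\<^sub>v u) (b \<bullet> u) (B *\<^sub>v u)"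
      if "x \<in> carrier_vec nx" "f \<in> carrier_vec ny" "u \<in> carrier_vec N" for x f t u
      unfolding rep_constraint_def eq[OF that] by (rule refl)
  qed (use R in \<open>simp_all add: m_def\<close>)
qed

section \<open>Coordinate projections as matrices and scalar products\<close>

text \<open>Each row has a single one, in column \<open>d + r\<close>, and the bound keeps that
  column in range. This provides block projections in the matrix form that the pullback
  requires.\<close>

lemma selection_mat_mult_vec:
  fixes u :: "real vec"
  assumes "u \<in> carrier_vec N" and "d + m \<le> N"
  shows "mat m N (\<lambda>(r, j). of_bool (j = d + r)) *\<^sub>v u = vec m (\<lambda>r. u $ (d + r))"
  using assms by (intro eq_vecI) (auto simp: scalar_prod_def of_bool_def if_distrib if_distribR cong: if_cong)

text \<open>The entry of \<open>c\<close> at \<open>j\<close> collects the weights of all indices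
  that \<open>g\<close> sends to \<open>j\<close>. This brings the right-hand sides of the equations
  for \<open>f\<close> and \<open>t\<close> into the form \<open>c \<bullet> u\<close>.\<close>

lemma weighted_coordinates_functional:
  fixes w :: "'a \<Rightarrow> real"
  assumes "finite A" and "\<And>i. i \<in> A \<Longrightarrow> g i < N"
  obtains c where "c \<in> carrier_vec N"
    and "\<And>u. u \<in> carrier_vec N \<Longrightarrow> c \<bullet> u = (\<Sum>i\<in>A. w i * u $ g i)"
proof
  let ?c = "vec N (\<lambda>j. \<Sum>i\<in>A. w i * of_bool (j = g i))"
  show "?c \<in> carrier_vec N" by simp
  show "?c \<bullet> u = (\<Sum>i\<in>A. w i * u $ g i)" if "u \<in> carrier_vec N" for u
  proof -
    have "?c \<bullet> u = (\<Sum>j<N. \<Sum>i\<in>A. w i * of_bool (j = g i) * u $ j)"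
      using that by (simp add: scalar_prod_def sum_distrib_right atLeast0LessThan)
    also have "\<dots> = (\<Sum>i\<in>A. \<Sum>j<N. w i * of_bool (j = g i) * u $ j)"
      by (rule sum.swap)
    also have "\<dots> = (\<Sum>i\<in>A. w i * u $ g i)"
      using assms by (intro sum.cong) (auto simp: of_bool_def if_distrib if_distribR cong: if_cong)
    finally show ?thesis .
  qed
qed

section \<open>The stacked vector of variables and its blocks\<close>

lemma append_vec_assoc: "(u @\<^sub>v v) @\<^sub>v w = u @\<^sub>v (v @\<^sub>v w)"
  by (rule eq_vecI) auto

text \<open>\<open>append_vecs\<close> folds from the right, whereas induction on the number of
  summands adds a block at the end.\<close>

lemma append_vecs_snoc: "append_vecs (vs @ [v]) = append_vecs vs @\<^sub>v v"
proof (induction vs)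
  case Nil
  show ?case by (auto simp: append_vecs_def intro!: eq_vecI)
next
  case (Cons a vs)
  then show ?case by (simp add: append_vecs_def append_vec_assoc)
qed

lemma stack_vars_0: "stack_vars 0 F T U = 0\<^sub>v 0"
  by (simp add: stack_vars_def append_vecs_def)

lemma stack_vars_Suc:
  "stack_vars (Suc I) F T U =
   stack_vars I F T U @\<^sub>v (F (Suc I) @\<^sub>v vCons (T (Suc I)) (U (Suc I)))"
  by (simp add: stack_vars_def append_vecs_snoc)

lemma stack_vars_cong:
  assumes "\<And>i. i \<in> {1..I} \<Longrightarrow> F i = F' i \<and> T i = T' i \<and> U i = U' i"
  shows "stack_vars I F T U = stack_vars I F' T' U'"
  using assms unfolding stack_vars_def by (intro arg_cong[of _ _ append_vecs]) auto

text \<open>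
  Block i occupies the positions from \<open>stack_offset ny Q i\<close> on; the whole stacked vector has
  dimension \<open>stack_offset ny Q (Suc I)\<close>.
\<close>

definition stack_offset :: "nat \<Rightarrow> (nat \<Rightarrow> real mat) \<Rightarrow> nat \<Rightarrow> nat" where
  "stack_offset ny Q i = (\<Sum>j=1..<i. ny + 1 + dim_col (Q j))"

lemma stack_offset_Suc:
  "1 \<le> i \<Longrightarrow> stack_offset ny Q (Suc i) = stack_offset ny Q i + (ny + 1 + dim_col (Q i))"
  by (simp add: stack_offset_def)

lemma stack_offset_mono: "i \<le> j \<Longrightarrow> stack_offset ny Q i \<le> stack_offset ny Q j"
  unfolding stack_offset_def by (intro sum_mono2) auto

lemma stack_offset_block_le:
  assumes "i \<in> {1..I}"
  shows "stack_offset ny Q i + (ny + 1 + dim_col (Q i)) \<le> stack_offset ny Q (Suc I)"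
  using stack_offset_mono[of "Suc i" "Suc I" ny Q] assms by (simp add: stack_offset_Suc)

lemma system_vars_Suc:
  "system_vars ny (Suc I) Q F U \<longleftrightarrow>
   system_vars ny I Q F U \<and> F (Suc I) \<in> carrier_vec ny \<and> U (Suc I) \<in> carrier_vec (dim_col (Q (Suc I)))"
  by (auto simp: system_vars_def atLeastAtMostSuc_conv)

lemma dim_stack_vars:
  "system_vars ny I Q F U \<Longrightarrow> dim_vec (stack_vars I F T U) = stack_offset ny Q (Suc I)"
proof (induction I)
  case 0
  show ?case by (simp add: stack_vars_0 stack_offset_def)
next
  case (Suc I)
  then have "system_vars ny I Q F U" "dim_vec (F (Suc I)) = ny"
    "dim_vec (U (Suc I)) = dim_col (Q (Suc I))"
    by (auto simp: system_vars_Suc)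
  then show ?case
    using Suc.IH by (simp add: stack_vars_Suc stack_offset_Suc[of "Suc I"])
qed

text \<open>By induction on \<open>I\<close>: the newest block starts at the dimension of the stack
  before it, and every older block ends by that position, so appending leaves its entries
  unchanged.\<close>

lemma index_stack_vars:
  assumes "system_vars ny I Q F U" and "i \<in> {1..I}" and "r < ny + 1 + dim_col (Q i)"
  shows "stack_vars I F T U $ (stack_offset ny Q i + r) = (F i @\<^sub>v vCons (T i) (U i)) $ r"
  using assms(1,2)
proof (induction I)
  case 0
  then show ?case by simp
next
  case (Suc I)
  from Suc.prems have I: "system_vars ny I Q F U" and F: "F (Suc I) \<in> carrier_vec ny"
    and U: "U (Suc I) \<in> carrier_vec (dim_col (Q (Suc I)))"
    by (auto simp: system_vars_Suc)
  show ?case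
  proof (cases "i = Suc I")
    case True
    then show ?thesis
      using F U assms(3) by (simp add: stack_vars_Suc dim_stack_vars[OF I])
  next
    case False
    then have i: "i \<in> {1..I}"
      using Suc.prems by auto
    have "stack_offset ny Q i + r < stack_offset ny Q (Suc I)"
      using stack_offset_block_le[OF i, of ny Q] assms(3) by simp
    then show ?thesis
      using Suc.IH[OF I i] by (simp add: stack_vars_Suc dim_stack_vars[OF I])
  qed
qed

text \<open>This ensures that an infimum over all \<open>u\<close> of the stacked dimension sees no
  points beyond those given by the separate variables. Blocks are cut off from the end.\<close>

lemma stack_vars_surj:
  "u \<in> carrier_vec (stack_offset ny Q (Suc I)) \<Longrightarrow>
   \<exists>F T U. system_vars ny I Q F U \<and> stack_vars I F T U = u"
proof (induction I arbitrary: u)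
  case 0
  then show ?case
    by (auto simp: stack_vars_0 stack_offset_def system_vars_def)
next
  case (Suc I)
  define d where "d = dim_col (Q (Suc I))"
  have u: "u \<in> carrier_vec (stack_offset ny Q (Suc I) + (ny + Suc d))"
    using Suc.prems by (simp add: stack_offset_Suc[of "Suc I"] d_def)
  \<comment> \<open>\<open>w\<close> is the last block, and \<open>z\<close> is what remains of it
    after the first \<open>ny\<close> entries: its head is the value of \<open>T\<close>, its tail
    the value of \<open>U\<close>.\<close>
  define w where "w = vec_last u (ny + Suc d)"
  define z where "z = vec_last w (Suc d)"
  obtain F T U where FTU: "system_vars ny I Q F U"
    "stack_vars I F T U = vec_first u (stack_offset ny Q (Suc I))"
    using Suc.IH vec_first_carrier by blast
  \<comment> \<open>Updating only at \<open>Suc I\<close> leaves the stack of the first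
    \<open>I\<close> blocks as the induction hypothesis gave it.\<close>
  define F' where "F' = F(Suc I := vec_first w ny)"
  define T' where "T' = T(Suc I := z $ 0)"
  define U' where "U' = U(Suc I := vec d (\<lambda>r. z $ Suc r))"
  have "z \<in> carrier_vec (Suc d)" "w \<in> carrier_vec (ny + Suc d)"
    by (simp_all add: z_def w_def)
  then have "vCons (z $ 0) (vec d (\<lambda>r. z $ Suc r)) = z"
    by (intro eq_vecI) (auto simp: vec_index_vCons gr0_conv_Suc less_Suc_eq_0_disj)
  then have "F' (Suc I) @\<^sub>v vCons (T' (Suc I)) (U' (Suc I)) = w"
    using vec_first_last_append[of w ny "Suc d"] \<open>w \<in> _\<close>
    by (simp add: F'_def T'_def U'_def z_def)
  moreover have "stack_vars I F' T' U' = vec_first u (stack_offset ny Q (Suc I))"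
    unfolding FTU(2)[symmetric] by (rule stack_vars_cong) (auto simp: F'_def T'_def U'_def)
  ultimately have "stack_vars (Suc I) F' T' U' = u"
    using vec_first_last_append[OF u] by (simp add: stack_vars_Suc w_def)
  moreover have "system_vars ny (Suc I) Q F' U'"
    using FTU(1) by (auto simp: system_vars_def F'_def U'_def d_def)
  ultimately show ?case by blast
qed

section \<open>The system of the weighted sum as one conic constraint\<close>

text \<open>The predicate \<open>C\<close> is stated through coordinates of \<open>u\<close> alone,
  which makes it conic expressible; on a stacked vector the projections return \<open>F i\<close>,
  \<open>T i\<close> and \<open>U i\<close>, which turns it into \<open>sum_system\<close>.\<close>

lemma conic_expressible_sum_system:
  assumes fam: "cone_family \<K>"
    and rep: "\<And>i. i \<in> {1..I} \<Longrightarrow> K i \<in> \<K> \<and> K i \<subseteq> carrier_vec (dim_vec (s i)) \<and>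
      P i \<in> carrier_mat (dim_vec (s i)) ny \<and> p i \<in> carrier_vec (dim_vec (s i)) \<and>
      Q i \<in> carrier_mat (dim_vec (s i)) (dim_col (Q i)) \<and> R i \<in> carrier_mat (dim_vec (s i)) nx"
  obtains C where "conic_expressible \<K> nx ny (stack_offset ny Q (Suc I)) C"
    and "\<And>x f t F T U. f \<in> carrier_vec ny \<Longrightarrow> system_vars ny I Q F U \<Longrightarrow>
           C x f t (stack_vars I F T U) \<longleftrightarrow> sum_system ny I \<theta> K P p Q R s x f t F T U"
proof
  define N where "N = stack_offset ny Q (Suc I)"
  define off where "off = stack_offset ny Q"
  \<comment> \<open>\<open>A i\<close>, \<open>b i\<close> and \<open>B i\<close> read the three
    parts of block \<open>i\<close>. The shift by \<open>ny + 1\<close> in \<open>B i\<close> skips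
    the \<open>F\<close> part and the single coordinate holding \<open>T i\<close>.\<close>
  define A where "A i = mat ny N (\<lambda>(r, j). of_bool (j = off i + r) :: real)" for i
  define b where "b i = (unit_vec N (off i + ny) :: real vec)" for i
  define B where
    "B i = mat (dim_col (Q i)) N (\<lambda>(r, j). of_bool (j = off i + ny + 1 + r) :: real)" for i
  have le: "off i + (ny + 1 + dim_col (Q i)) \<le> N" if "i \<in> {1..I}" for i
    using stack_offset_block_le[OF that] by (simp add: off_def N_def)
  \<comment> \<open>The vector equation for \<open>f\<close> is split into \<open>ny\<close> scalar
    equations, one per coordinate, so that each is a linear equation of the kind already
    treated.\<close>
  let ?C = "\<lambda>x f t u. ((\<forall>k\<in>{..<ny}. f $ k = (\<Sum>i=1..I. \<theta> i * u $ (off i + k))) \<and>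
      t = (\<Sum>i=1..I. \<theta> i * u $ (off i + ny))) \<and>
      (\<forall>i\<in>{1..I}. rep_constraint (K i) (P i) (p i) (Q i) (R i) (s i) x
         (A i *\<^sub>v u) (b i \<bullet> u) (B i *\<^sub>v u))"
  have "conic_expressible \<K> nx ny N (\<lambda>x f t u. f $ k = (\<Sum>i=1..I. \<theta> i * u $ (off i + k)))"
    if "k < ny" for k
  proof -
    have lt: "off i + k < N" if "i \<in> {1..I}" for i
      using le[OF that] \<open>k < ny\<close> by simp
    obtain c where c: "c \<in> carrier_vec N"
      "\<And>u. u \<in> carrier_vec N \<Longrightarrow> c \<bullet> u = (\<Sum>i=1..I. \<theta> i * u $ (off i + k))"
      by (rule weighted_coordinates_functional[of "{1..I}" "\<lambda>i. off i + k" N \<theta>,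
          OF finite_atLeastAtMost lt]) (assumption, rule that, assumption+)
    show ?thesis
      \<comment> \<open>The unit vector together with coefficient 0 for \<open>t\<close> isolates
        \<open>f $ k\<close>; the equation for \<open>t\<close> below uses the zero vector and
        coefficient 1.\<close>
      by (rule conic_expressible_cong[OF conic_expressible_equation[OF fam
            unit_vec_carrier[of ny k] c(1), of nx 0]])
         (use c(2) \<open>k < ny\<close> in auto)
  qed
  moreover have "conic_expressible \<K> nx ny N (\<lambda>x f t u. t = (\<Sum>i=1..I. \<theta> i * u $ (off i + ny)))"
  proof -
    have lt: "off i + ny < N" if "i \<in> {1..I}" for i
      using le[OF that] by simp
    obtain c where c: "c \<in> carrier_vec N"
      "\<And>u. u \<in> carrier_vec N \<Longrightarrow> c \<bullet> u = (\<Sum>i=1..I. \<theta> i * u $ (off i + ny))"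
      by (rule weighted_coordinates_functional[of "{1..I}" "\<lambda>i. off i + ny" N \<theta>,
          OF finite_atLeastAtMost lt]) (assumption, rule that, assumption+)
    show ?thesis
      by (rule conic_expressible_cong[OF conic_expressible_equation[OF fam
            zero_carrier_vec[of ny] c(1), of nx 1]])
         (use c(2) in auto)
  qed
  moreover have "conic_expressible \<K> nx ny N (\<lambda>x f t u. rep_constraint (K i) (P i) (p i) (Q i)
      (R i) (s i) x (A i *\<^sub>v u) (b i \<bullet> u) (B i *\<^sub>v u))" if "i \<in> {1..I}" for i
    by (rule conic_expressible_pullback[where k = "dim_col (Q i)"])
       (use rep[OF that] in \<open>auto simp: A_def b_def B_def\<close>)
  ultimately show "conic_expressible \<K> nx ny (stack_offset ny Q (Suc I)) ?C"
    unfolding N_def[symmetric]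
    by (intro conic_expressible_conj[OF fam] conic_expressible_Ball[OF fam]) auto
  fix x f :: "real vec" and t :: real and F T U
  assume f: "f \<in> carrier_vec ny" and sys: "system_vars ny I Q F U"
  let ?u = "stack_vars I F T U"
  have u: "?u \<in> carrier_vec N"
    using dim_stack_vars[OF sys] by (auto simp: N_def intro: carrier_vecI)
  have FU: "F i \<in> carrier_vec ny" "U i \<in> carrier_vec (dim_col (Q i))" if "i \<in> {1..I}" for i
    using sys that by (auto simp: system_vars_def)
  have idxF: "?u $ (off i + k) = F i $ k" if "i \<in> {1..I}" "k < ny" for i k
    using index_stack_vars[OF sys, of i k T] FU[OF that(1)] that by (simp add: off_def)
  have idxT: "?u $ (off i + ny) = T i" if "i \<in> {1..I}" for i
    using index_stack_vars[OF sys, of i ny T] FU[OF that] that by (simp add: off_def)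
  have idxU: "?u $ (off i + ny + 1 + k) = U i $ k" if "i \<in> {1..I}" "k < dim_col (Q i)" for i k
    using index_stack_vars[OF sys, of i "ny + 1 + k" T] FU[OF that(1)] that
    by (simp add: off_def add.assoc)
  have "A i *\<^sub>v ?u = F i" "b i \<bullet> ?u = T i" "B i *\<^sub>v ?u = U i" if i: "i \<in> {1..I}" for i
  proof -
    show "A i *\<^sub>v ?u = F i"
      unfolding A_def using le[OF i] FU[OF i] idxF[OF i]
      by (subst selection_mat_mult_vec[OF u]) (auto intro!: eq_vecI)
    show "b i \<bullet> ?u = T i"
      unfolding b_def using le[OF i] idxT[OF i] u by simp
    show "B i *\<^sub>v ?u = U i"
      unfolding B_def using le[OF i] FU[OF i] idxU[OF i]
      by (subst selection_mat_mult_vec[OF u]) (auto intro!: eq_vecI)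
  qed
  moreover have "(\<Sum>i=1..I. \<theta> i * ?u $ (off i + ny)) = (\<Sum>i=1..I. \<theta> i * T i)"
    using idxT by (intro sum.cong) auto
  moreover have "(\<forall>k\<in>{..<ny}. f $ k = (\<Sum>i=1..I. \<theta> i * ?u $ (off i + k))) \<longleftrightarrow>
      f = finsum_vec TYPE(real) ny (\<lambda>i. \<theta> i \<cdot>\<^sub>v F i) {1..I}"
  proof -
    have "(\<lambda>i. \<theta> i \<cdot>\<^sub>v F i) \<in> {1..I} \<rightarrow> carrier_vec ny"
      using FU by auto
    then have G: "finsum_vec TYPE(real) ny (\<lambda>i. \<theta> i \<cdot>\<^sub>v F i) {1..I} \<in> carrier_vec ny"
      "\<And>k. k < ny \<Longrightarrow> finsum_vec TYPE(real) ny (\<lambda>i. \<theta> i \<cdot>\<^sub>v F i) {1..I} $ k =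
         (\<Sum>i=1..I. (\<theta> i \<cdot>\<^sub>v F i) $ k)"
      by (auto intro!: finsum_vec_closed index_finsum_vec)
    have "(\<Sum>i=1..I. (\<theta> i \<cdot>\<^sub>v F i) $ k) = (\<Sum>i=1..I. \<theta> i * ?u $ (off i + k))" if "k < ny" for k
      using carrier_vecD[OF FU(1)] idxF that by (intro sum.cong) auto
    then show ?thesis
      using f G by (auto intro!: eq_vecI)
  qed
  ultimately show "?C x f t ?u \<longleftrightarrow> sum_system ny I \<theta> K P p Q R s x f t F T U"
    unfolding sum_system_def by auto
qed

section \<open>The value identity, and convexity and continuity of weighted sums\<close>

text \<open>One inequality holds term by term. For the other, each infimum is a real number, so
  every \<open>S i\<close> has an element within any positive distance of it, and these elements may
  be chosen independently.\<close>

lemma Inf_weighted_sum: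
  fixes a \<theta> :: "'a \<Rightarrow> real"
  assumes "finite A" and \<theta>: "\<And>i. i \<in> A \<Longrightarrow> 0 \<le> \<theta> i"
    and Inf: "\<And>i. i \<in> A \<Longrightarrow> ereal (a i) = Inf (ereal ` S i)"
  shows "ereal (\<Sum>i\<in>A. \<theta> i * a i) = Inf {ereal (\<Sum>i\<in>A. \<theta> i * g i) | g. \<forall>i\<in>A. g i \<in> S i}"
    (is "_ = Inf ?G")
proof (rule antisym)
  show "ereal (\<Sum>i\<in>A. \<theta> i * a i) \<le> Inf ?G"
  proof (rule Inf_greatest, clarify)
    fix g assume g: "\<forall>i\<in>A. g i \<in> S i"
    have "a i \<le> g i" if "i \<in> A" for i
      using Inf_lower[of "ereal (g i)" "ereal ` S i"] g that Inf[OF that, symmetric] by simp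
    then show "ereal (\<Sum>i\<in>A. \<theta> i * a i) \<le> ereal (\<Sum>i\<in>A. \<theta> i * g i)"
      using \<theta> by (auto intro!: sum_mono mult_left_mono)
  qed
  show "Inf ?G \<le> ereal (\<Sum>i\<in>A. \<theta> i * a i)"
  proof (rule ereal_le_epsilon2)
    show "Inf ?G \<le> ereal (\<Sum>i\<in>A. \<theta> i * a i) + ereal e" if "e > 0" for e
    proof -
      \<comment> \<open>The tolerance makes the total weighted error at most \<open>e\<close>; the
        added 1 keeps the denominator positive when the weights sum to zero, as they do for empty
        \<open>A\<close>.\<close>
      define d where "d = e / (sum \<theta> A + 1)"
      have W: "sum \<theta> A \<ge> 0"
        using \<theta> by (rule sum_nonneg)
      then have "d > 0"
        using \<open>e > 0\<close> by (simp add: d_def)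
      have "\<exists>v\<in>S i. v < a i + d" if "i \<in> A" for i
        using Inf_less_iff[of "ereal ` S i" "ereal (a i + d)"] Inf[OF that, symmetric] \<open>d > 0\<close> by auto
      then obtain g where g: "\<And>i. i \<in> A \<Longrightarrow> g i \<in> S i \<and> g i < a i + d"
        by metis
      have "(\<Sum>i\<in>A. \<theta> i * g i) \<le> (\<Sum>i\<in>A. \<theta> i * (a i + d))"
        using g \<theta> by (intro sum_mono mult_left_mono) (auto intro: less_imp_le)
      also have "\<dots> = (\<Sum>i\<in>A. \<theta> i * a i) + sum \<theta> A * d"
        by (simp add: distrib_left sum.distrib sum_distrib_right)
      also have "sum \<theta> A * d \<le> e"
        using W \<open>e > 0\<close> by (simp add: d_def field_simps)
      finally have "ereal (\<Sum>i\<in>A. \<theta> i * g i) \<le> ereal (\<Sum>i\<in>A. \<theta> i * a i) + ereal e"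
        by simp
      moreover have "Inf ?G \<le> ereal (\<Sum>i\<in>A. \<theta> i * g i)"
        using g by (intro Inf_lower) auto
      ultimately show "Inf ?G \<le> ereal (\<Sum>i\<in>A. \<theta> i * a i) + ereal e"
        by (rule order_trans[rotated])
    qed
  qed
qed

lemma finsum_vec_scalar_prod:
  fixes y :: "real vec"
  assumes "finite A" and "v \<in> A \<rightarrow> carrier_vec n" and "y \<in> carrier_vec n"
  shows "finsum_vec TYPE(real) n v A \<bullet> y = (\<Sum>i\<in>A. v i \<bullet> y)"
proof -
  have "finsum_vec TYPE(real) n v A \<bullet> y = (\<Sum>k<n. \<Sum>i\<in>A. v i $ k * y $ k)"
    using assms by (simp add: scalar_prod_def index_finsum_vec sum_distrib_right atLeast0LessThan)
  also have "\<dots> = (\<Sum>i\<in>A. \<Sum>k<n. v i $ k * y $ k)"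
    by (rule sum.swap)
  also have "\<dots> = (\<Sum>i\<in>A. v i \<bullet> y)"
    using assms by (simp add: scalar_prod_def atLeast0LessThan)
  finally show ?thesis .
qed

lemma convex_concave_on_weighted_sum:
  assumes "\<And>i. i \<in> A \<Longrightarrow> 0 \<le> \<theta> i" and "\<And>i. i \<in> A \<Longrightarrow> convex_concave_on X Y (\<psi> i)"
  shows "convex_concave_on X Y (\<lambda>x y. \<Sum>i\<in>A. \<theta> i * \<psi> i x y)"
proof -
  \<comment> \<open>Rewriting with this moves convex combinations inside the weighted sum, so both
    the convexity and the concavity inequality can be compared term by term.\<close>
  have *: "a * (\<Sum>i\<in>A. \<theta> i * g i) + (1 - a) * (\<Sum>i\<in>A. \<theta> i * h i) =
      (\<Sum>i\<in>A. \<theta> i * (a * g i + (1 - a) * h i))" for a and g h :: "_ \<Rightarrow> real"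
    unfolding sum_distrib_left sum.distrib[symmetric] by (intro sum.cong) (auto simp: algebra_simps)
  show ?thesis
    unfolding convex_concave_on_def *
    using assms(2) by (intro conjI ballI sum_mono mult_left_mono assms(1))
      (auto simp: convex_concave_on_def)
qed

lemma jointly_continuous_on_weighted_sum:
  assumes "finite A" and "\<And>i. i \<in> A \<Longrightarrow> jointly_continuous_on nx ny X Y (\<psi> i)"
  shows "jointly_continuous_on nx ny X Y (\<lambda>x y. \<Sum>i\<in>A. \<theta> i * \<psi> i x y)"
  using assms unfolding jointly_continuous_on_def case_prod_unfold
  by (intro continuous_map_sum continuous_map_real_mult_left) auto

text \<open>The system determines \<open>f\<close> and \<open>t\<close> from \<open>F\<close> and
  \<open>T\<close>, and the objective then equals the weighted sum of the separate objectives. The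
  attainable values are therefore exactly the weighted sums of attainable values of the
  summands.\<close>

lemma sum_system_Inf:
  assumes y: "y \<in> carrier_vec ny" and \<theta>: "\<And>i. i \<in> {1..I} \<Longrightarrow> 0 \<le> \<theta> i"
    and Inf: "\<And>i. i \<in> {1..I} \<Longrightarrow>
      ereal (a i) = Inf {ereal (f \<bullet> y + t) | f t u.
        f \<in> carrier_vec ny \<and> u \<in> carrier_vec (dim_col (Q i)) \<and>
        rep_constraint (K i) (P i) (p i) (Q i) (R i) (s i) x f t u}"
  shows "ereal (\<Sum>i=1..I. \<theta> i * a i) =
    Inf {ereal (f \<bullet> y + t) | f t F T U.
      f \<in> carrier_vec ny \<and> system_vars ny I Q F U \<and>
      sum_system ny I \<theta> K P p Q R s x f t F T U}" (is "_ = Inf ?H")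
proof -
  let ?S = "\<lambda>i. {f \<bullet> y + t | f t u.
        f \<in> carrier_vec ny \<and> u \<in> carrier_vec (dim_col (Q i)) \<and>
        rep_constraint (K i) (P i) (p i) (Q i) (R i) (s i) x f t u}"
  let ?G = "{ereal (\<Sum>i=1..I. \<theta> i * g i) | g. \<forall>i\<in>{1..I}. g i \<in> ?S i}"
  have closed: "finsum_vec TYPE(real) ny (\<lambda>i. \<theta> i \<cdot>\<^sub>v F i) {1..I} \<in> carrier_vec ny"
    and obj: "finsum_vec TYPE(real) ny (\<lambda>i. \<theta> i \<cdot>\<^sub>v F i) {1..I} \<bullet> y + (\<Sum>i=1..I. \<theta> i * T i) =
       (\<Sum>i=1..I. \<theta> i * (F i \<bullet> y + T i))"
    if "\<And>i. i \<in> {1..I} \<Longrightarrow> F i \<in> carrier_vec ny" for F T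
  proof -
    have F: "(\<lambda>i. \<theta> i \<cdot>\<^sub>v F i) \<in> {1..I} \<rightarrow> carrier_vec ny"
      using that by auto
    show "finsum_vec TYPE(real) ny (\<lambda>i. \<theta> i \<cdot>\<^sub>v F i) {1..I} \<in> carrier_vec ny"
      using F by (rule finsum_vec_closed)
    have "(\<Sum>i=1..I. (\<theta> i \<cdot>\<^sub>v F i) \<bullet> y) = (\<Sum>i=1..I. \<theta> i * (F i \<bullet> y))"
      using that y by (intro sum.cong) auto
    then show "finsum_vec TYPE(real) ny (\<lambda>i. \<theta> i \<cdot>\<^sub>v F i) {1..I} \<bullet> y + (\<Sum>i=1..I. \<theta> i * T i) =
       (\<Sum>i=1..I. \<theta> i * (F i \<bullet> y + T i))"
      using finsum_vec_scalar_prod[OF _ F y] by (simp add: distrib_left sum.distrib)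
  qed
  have "?G = ?H"
  proof (intro equalityI subsetI)
    fix z assume "z \<in> ?G"
    then obtain g where z: "z = ereal (\<Sum>i=1..I. \<theta> i * g i)"
      and "\<forall>i\<in>{1..I}. \<exists>f t u. g i = f \<bullet> y + t \<and> f \<in> carrier_vec ny \<and> u \<in> carrier_vec (dim_col (Q i)) \<and>
        rep_constraint (K i) (P i) (p i) (Q i) (R i) (s i) x f t u"
      by blast
    \<comment> \<open>One choice per index: for given \<open>x\<close> no constraint couples
      different summands, so their feasible points combine freely.\<close>
    then obtain F T U where FTU: "\<forall>i\<in>{1..I}. g i = F i \<bullet> y + T i \<and> F i \<in> carrier_vec ny \<and>
        U i \<in> carrier_vec (dim_col (Q i)) \<and>
        rep_constraint (K i) (P i) (p i) (Q i) (R i) (s i) x (F i) (T i) (U i)"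
      unfolding bchoice_iff by (elim exE) (rule that)
    have "z = ereal (\<Sum>i=1..I. \<theta> i * (F i \<bullet> y + T i))"
      unfolding z using FTU by simp
    also have "\<dots> = ereal (finsum_vec TYPE(real) ny (\<lambda>i. \<theta> i \<cdot>\<^sub>v F i) {1..I} \<bullet> y +
        (\<Sum>i=1..I. \<theta> i * T i))"
      using obj[of F T] FTU by simp
    finally have "z = \<dots>" .
    moreover have "finsum_vec TYPE(real) ny (\<lambda>i. \<theta> i \<cdot>\<^sub>v F i) {1..I} \<in> carrier_vec ny"
      using closed[of F] FTU by simp
    moreover have "system_vars ny I Q F U"
      using FTU by (simp add: system_vars_def)
    moreover have "sum_system ny I \<theta> K P p Q R s x (finsum_vec TYPE(real) ny (\<lambda>i. \<theta> i \<cdot>\<^sub>v F i) {1..I})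
        (\<Sum>i=1..I. \<theta> i * T i) F T U"
      using FTU by (simp add: sum_system_def)
    ultimately show "z \<in> ?H"
      by blast
  next
    fix z assume "z \<in> ?H"
    then obtain F T U where sys: "system_vars ny I Q F U"
      and con: "\<forall>i\<in>{1..I}. rep_constraint (K i) (P i) (p i) (Q i) (R i) (s i) x (F i) (T i) (U i)"
      and z: "z = ereal (finsum_vec TYPE(real) ny (\<lambda>i. \<theta> i \<cdot>\<^sub>v F i) {1..I} \<bullet> y +
        (\<Sum>i=1..I. \<theta> i * T i))"
      unfolding sum_system_def by blast
    have "z = ereal (\<Sum>i=1..I. \<theta> i * (F i \<bullet> y + T i))"
      unfolding z using obj[of F T] sys by (simp add: system_vars_def)
    moreover have "\<forall>i\<in>{1..I}. F i \<bullet> y + T i \<in> ?S i"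
      using sys con unfolding system_vars_def by blast
    ultimately show "z \<in> ?G"
      unfolding mem_Collect_eq by (intro exI[of _ "\<lambda>i. F i \<bullet> y + T i"] conjI)
  qed
  moreover have "ereal (\<Sum>i=1..I. \<theta> i * a i) = Inf ?G"
    by (rule Inf_weighted_sum) (use \<theta> Inf in \<open>auto simp: setcompr_eq_image image_def intro!: arg_cong[of _ _ Inf]\<close>)
  ultimately show ?thesis
    by simp
qed

section \<open>Assembling the representation of the weighted sum\<close>

theorem mainTheorem19:
  fixes \<K> :: "real vec set set"
    and nx ny I :: nat
    and X Y :: "real vec set"
    and \<theta> :: "nat \<Rightarrow> real"
    and \<psi> :: "nat \<Rightarrow> real vec \<Rightarrow> real vec \<Rightarrow> real"
    and K :: "nat \<Rightarrow> real vec set"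
    and P Q R :: "nat \<Rightarrow> real mat"
    and p s :: "nat \<Rightarrow> real vec"
  assumes "cone_family \<K>"
    and "X \<noteq> {}" and "vec_convex X" and "representable_set \<K> nx X"
    and "Y \<noteq> {}" and "vec_convex Y" and "representable_set \<K> ny Y"
    and "\<forall>i\<in>{1..I}. \<theta> i > 0"
    and "\<forall>i\<in>{1..I}. K_representation \<K> nx ny X Y (\<psi> i) (K i) (P i) (p i) (Q i) (R i) (s i)"
  shows
    "(\<forall>x\<in>X. \<forall>y\<in>Y.
        ereal (\<Sum>i=1..I. \<theta> i * \<psi> i x y) =
        Inf {ereal (f \<bullet> y + t) | f t F T U.
               f \<in> carrier_vec ny \<and> system_vars ny I Q F U \<and>
               sum_system ny I \<theta> K P p Q R s x f t F T U}) \<and>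
     (\<exists>K' P' p' Q' R' s'.
        K_representation \<K> nx ny X Y (\<lambda>x y. \<Sum>i=1..I. \<theta> i * \<psi> i x y) K' P' p' Q' R' s' \<and>
        dim_col Q' = (\<Sum>i=1..I. ny + 1 + dim_col (Q i)) \<and>
        (\<forall>x\<in>carrier_vec nx. \<forall>f\<in>carrier_vec ny. \<forall>t F T U.
           system_vars ny I Q F U \<longrightarrow>
           (rep_constraint K' P' p' Q' R' s' x f t (stack_vars I F T U) \<longleftrightarrow>
            sum_system ny I \<theta> K P p Q R s x f t F T U)))"
proof -
  note fam = assms(1) and \<theta> = assms(8) and rep = assms(9)
  \<comment> \<open>Representability places both sets in spaces of the right dimension, where the
    conic equivalences and the scalar product identities apply.\<close>
  have X: "X \<subseteq> carrier_vec nx" and Y: "Y \<subseteq> carrier_vec ny"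
    using assms(4,7) unfolding representable_set_def by auto
  define N where "N = stack_offset ny Q (Suc I)"
  have N: "N = (\<Sum>i=1..I. ny + 1 + dim_col (Q i))"
    by (simp add: N_def stack_offset_def atLeastLessThanSuc_atLeastAtMost)
  have val: "ereal (\<Sum>i=1..I. \<theta> i * \<psi> i x y) =
      Inf {ereal (f \<bullet> y + t) | f t F T U.
        f \<in> carrier_vec ny \<and> system_vars ny I Q F U \<and>
        sum_system ny I \<theta> K P p Q R s x f t F T U}" if "x \<in> X" "y \<in> Y" for x y
    using that Y \<theta> rep by (intro sum_system_Inf) (auto simp: K_representation_def less_imp_le)
  have rep': "K i \<in> \<K> \<and> K i \<subseteq> carrier_vec (dim_vec (s i)) \<and>
      P i \<in> carrier_mat (dim_vec (s i)) ny \<and> p i \<in> carrier_vec (dim_vec (s i)) \<and>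
      Q i \<in> carrier_mat (dim_vec (s i)) (dim_col (Q i)) \<and> R i \<in> carrier_mat (dim_vec (s i)) nx"
    if "i \<in> {1..I}" for i
    using rep that unfolding K_representation_def by simp
  obtain C where expr: "conic_expressible \<K> nx ny N C"
    and C: "\<And>x f t F T U. f \<in> carrier_vec ny \<Longrightarrow> system_vars ny I Q F U \<Longrightarrow>
           C x f t (stack_vars I F T U) \<longleftrightarrow> sum_system ny I \<theta> K P p Q R s x f t F T U"
    by (rule conic_expressible_sum_system[where I = I and K = K and s = s and P = P and
          ny = ny and p = p and Q = Q and R = R and nx = nx and \<theta> = \<theta>, folded N_def, OF fam rep'])
      (assumption, rule that, assumption+)
  obtain K' P' p' Q' R' s' where K': "K' \<in> \<K>" "K' \<subseteq> carrier_vec (dim_vec s')"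
    "P' \<in> carrier_mat (dim_vec s') ny" "p' \<in> carrier_vec (dim_vec s')"
    "Q' \<in> carrier_mat (dim_vec s') N" "R' \<in> carrier_mat (dim_vec s') nx"
    and eqC: "\<And>x f t u. x \<in> carrier_vec nx \<Longrightarrow> f \<in> carrier_vec ny \<Longrightarrow> u \<in> carrier_vec N \<Longrightarrow>
      rep_constraint K' P' p' Q' R' s' x f t u \<longleftrightarrow> C x f t u"
    using expr by (rule conic_expressibleE) (rule that, assumption+)
  have dimQ': "dim_col Q' = N"
    using K'(5) by auto
  have stack: "stack_vars I F T U \<in> carrier_vec N" if "system_vars ny I Q F U" for F T U
    using dim_stack_vars[OF that] by (auto simp: N_def intro: carrier_vecI)
  have iff: "rep_constraint K' P' p' Q' R' s' x f t (stack_vars I F T U) \<longleftrightarrow>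
      sum_system ny I \<theta> K P p Q R s x f t F T U"
    if "x \<in> carrier_vec nx" "f \<in> carrier_vec ny" "system_vars ny I Q F U" for x f t F T U
    using eqC[OF that(1,2) stack[OF that(3)]] C[OF that(2,3)] by simp
  have "ereal (\<Sum>i=1..I. \<theta> i * \<psi> i x y) =
      Inf {ereal (f \<bullet> y + t) | f t u. f \<in> carrier_vec ny \<and> u \<in> carrier_vec (dim_col Q') \<and>
        rep_constraint K' P' p' Q' R' s' x f t u}" if x: "x \<in> X" and y: "y \<in> Y" for x y
  proof -
    \<comment> \<open>Stacking carries solutions of the system to feasible \<open>u\<close>, and
      surjectivity of stacking gives the converse. For each pair \<open>f\<close>, \<open>t\<close>
      feasibility is thus the same in both forms, so the two infima range over the same set.\<close>
    have "(\<exists>u. u \<in> carrier_vec N \<and> rep_constraint K' P' p' Q' R' s' x f t u) \<longleftrightarrow>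
      (\<exists>F T U. system_vars ny I Q F U \<and> sum_system ny I \<theta> K P p Q R s x f t F T U)"
      if "f \<in> carrier_vec ny" for f t
      using iff[OF _ that] stack stack_vars_surj[of _ ny Q I] x X unfolding N_def by (metis subsetD)
    then have "{ereal (f \<bullet> y + t) | f t u. f \<in> carrier_vec ny \<and> u \<in> carrier_vec (dim_col Q') \<and>
        rep_constraint K' P' p' Q' R' s' x f t u} =
      {ereal (f \<bullet> y + t) | f t F T U. f \<in> carrier_vec ny \<and> system_vars ny I Q F U \<and>
        sum_system ny I \<theta> K P p Q R s x f t F T U}"
      unfolding dimQ' by blast
    then show ?thesis
      using val[OF x y] by simp
  qed
  moreover have "convex_concave_on X Y (\<lambda>x y. \<Sum>i=1..I. \<theta> i * \<psi> i x y)"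
    using \<theta> rep by (intro convex_concave_on_weighted_sum) (auto simp: K_representation_def less_imp_le)
  moreover have "jointly_continuous_on nx ny X Y (\<lambda>x y. \<Sum>i=1..I. \<theta> i * \<psi> i x y)"
    using rep by (intro jointly_continuous_on_weighted_sum) (auto simp: K_representation_def)
  ultimately have "K_representation \<K> nx ny X Y (\<lambda>x y. \<Sum>i=1..I. \<theta> i * \<psi> i x y) K' P' p' Q' R' s'"
    unfolding K_representation_def using K' dimQ' by auto
  then show ?thesis
    using val iff dimQ' N by blast
qed

end
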